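(* Take $n=3$, $p=(0,1,2)$, $\beta=\frac34\log2$ and $(\omega_1,\omega_2)=\left(\frac\pi2,\pi\right)$. For $a\in[0,1]$ (the energy in the first plane, so that the second plane has energy $1-a$), let $$W_{ij}(a)=\exp\Bigl(\beta\bigl[a\cos(\omega_1(p_i-p_j))+(1-a)\cos(\omega_2(p_i-p_j))\bigr]\Bigr),\qquad A_{ij}(a)=\frac{W_{ij}(a)}{\sum_kW_{ik}(a)},$$ and $\gamma(a)=1-\lambda_2(A(a))$. Then $$\gamma(0)=\frac{35\sqrt2-32}{31},\qquad \gamma(2/3)=\frac34,\qquad \gamma(1)=\frac{u(1+2u)}{1+u+u^2}\ \text{ with }u=2^{-3/4}.$$ In particular, $$\gamma(2/3)>\max\{\gamma(0),\gamma(1)\},$$ so $a\mapsto\gamma(a)$ is not generally monotone.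
   Context: $\lambda_2(A)$ denotes the second largest eigenvalue (with multiplicity) of $A$, whose eigenvalues are all real. $A(a)$ is the attention matrix, at a consensus state with plane energies $(a,1-a)$, of rotary self-attention with two rotation planes. *)

theory Defs
  imports
    Complex_Main
    "HOL-Library.Multiset"
    "HOL-Computational_Algebra.Polynomial"
    "Jordan_Normal_Form.Char_Poly"
begin

definition rotary_weight ::
    "real \<Rightarrow> real \<Rightarrow> real \<Rightarrow> (nat \<Rightarrow> real) \<Rightarrow> real \<Rightarrow> nat \<Rightarrow> nat \<Rightarrow> real" where
  "rotary_weight \<beta> \<omega>1 \<omega>2 p a i j =
     exp (\<beta> * (a * cos (\<omega>1 * (p i - p j)) + (1 - a) * cos (\<omega>2 * (p i - p j))))"

text \<open>Tokens are numbered \<open>0, \<dots>, n - 1\<close>, following the index convention of matrices in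
  \<open>Jordan_Normal_Form\<close>.\<close>

definition rotary_attention ::
    "nat \<Rightarrow> real \<Rightarrow> real \<Rightarrow> real \<Rightarrow> (nat \<Rightarrow> real) \<Rightarrow> real \<Rightarrow> real mat" where
  "rotary_attention n \<beta> \<omega>1 \<omega>2 p a =
     mat n n (\<lambda>(i, j). rotary_weight \<beta> \<omega>1 \<omega>2 p a i j /
                       (\<Sum>k<n. rotary_weight \<beta> \<omega>1 \<omega>2 p a i k))"

text \<open>The second entry of the decreasing list of roots of the characteristic polynomial, each
  repeated according to its multiplicity. This is the second largest eigenvalue when the
  matrix has size at least 2 and all its complex eigenvalues are real. The matrix
  \<open>rotary_attention n \<beta> \<omega>1 \<omega>2 p a\<close> is of this kind for \<open>n \<ge> 2\<close>: it is \<open>D\<inverse> W\<close> with \<open>W\<close> symmetric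
  and \<open>D\<close> a positive diagonal matrix, hence similar to a symmetric matrix.\<close>

definition lambda2 :: "real mat \<Rightarrow> real" where
  "lambda2 A = rev (sorted_list_of_multiset (proots (char_poly A))) ! 1"

end

theory Submission
  imports Defs
begin

text \<open>With the tokens at \<open>0, 1, 2\<close> and the frequencies \<open>\<pi>/2, \<pi>\<close>, all cosines are \<open>0\<close> or \<open>\<plusminus>1\<close>.
  After division by the common diagonal weight \<open>exp \<beta>\<close> the weight matrix has \<open>1\<close> on the diagonal,
  \<open>x = exp (\<beta> (a - 2))\<close> at distance one and \<open>y = exp (- 2 a \<beta>)\<close> at distance two. The attention
  matrix is therefore invariant under reversing the order of the tokens, and its rows sum to \<open>1\<close>.
  This determines its spectrum: the constant vector has eigenvalue \<open>1\<close>, the antisymmetric vector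
  \<open>(1, 0, -1)\<close> has eigenvalue \<open>(1 - y) / (1 + x + y)\<close>, and the trace yields the remaining one,
  \<open>1 / (1 + 2 x) - x / (1 + x + y)\<close>. As neither exceeds \<open>1\<close>, the second largest eigenvalue is
  the larger of these two.

  For \<open>\<beta> = 3/4 ln 2\<close> the three energies give \<open>(x, y) = (\<surd>2/4, 1)\<close> at \<open>a = 0\<close>, \<open>(1/2, 1/2)\<close> at
  \<open>a = 2/3\<close> and \<open>(u, u\<^sup>2)\<close> at \<open>a = 1\<close>. The symmetric mode has the larger eigenvalue at \<open>a = 0\<close>,
  the antisymmetric one at \<open>a = 1\<close>, and at \<open>a = 2/3\<close> both equal \<open>1/4\<close>. The gap is limited by a
  different mode at each end, and at the point where the two modes balance it exceeds both
  endpoint values.\<close>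

lemma det_dim_two:
  assumes "M \<in> carrier_mat 2 2"
  shows "det M = M $$ (0, 0) * M $$ (1, 1) - M $$ (0, 1) * M $$ (1, 0)"
  using assms
  by (simp add: laplace_expansion_row[OF assms, of 0] cofactor_def det_single mat_delete_def
      numeral_2_eq_2)

lemma det_dim_three:
  assumes "M \<in> carrier_mat 3 3"
  shows "det M =
      M $$ (0, 0) * (M $$ (1, 1) * M $$ (2, 2) - M $$ (1, 2) * M $$ (2, 1))
    - M $$ (0, 1) * (M $$ (1, 0) * M $$ (2, 2) - M $$ (1, 2) * M $$ (2, 0))
    + M $$ (0, 2) * (M $$ (1, 0) * M $$ (2, 1) - M $$ (1, 1) * M $$ (2, 0))"
proof -
  have minor: "mat_delete M 0 j \<in> carrier_mat 2 2" for j
    using assms by (auto simp: mat_delete_def)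
  have "det M = (\<Sum>j<3. M $$ (0, j) * cofactor M 0 j)"
    by (rule laplace_expansion_row[OF assms]) simp
  also have "\<dots> = M $$ (0, 0) * cofactor M 0 0 + M $$ (0, 1) * cofactor M 0 1
      + M $$ (0, 2) * cofactor M 0 2"
    by (simp add: numeral_3_eq_3 numeral_2_eq_2)
  finally show ?thesis
    unfolding cofactor_def det_dim_two[OF minor]
    using assms by (simp add: mat_delete_def numeral_2_eq_2 numeral_3_eq_3 right_diff_distrib)
qed

text \<open>The eigenvectors \<open>(1, 1, 1)\<close> and \<open>(1, 0, -1)\<close> account for the first two factors, and
  \<open>e - b\<close> is what they leave of the trace \<open>2 a + e = a + (1 - b - c) + e\<close>.\<close>

lemma char_poly_centrosymmetric_stochastic:
  fixes a b c d e :: "'a :: comm_ring_1"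
  assumes "a + b + c = 1" "2 * d + e = 1"
  shows "char_poly (mat_of_rows_list 3 [[a, b, c], [d, e, d], [c, b, a]]) =
         [:- 1, 1:] * [:- (a - c), 1:] * [:- (e - b), 1:]"
proof -
  have a: "a = 1 - b - c" and e: "e = 1 - 2 * d"
    using assms by (simp_all add: algebra_simps)
  let ?A = "mat_of_rows_list 3 [[a, b, c], [d, e, d], [c, b, a]]"
  have "char_poly_matrix ?A \<in> carrier_mat 3 3"
    by (intro char_poly_matrix_closed carrier_matI) (simp_all add: mat_of_rows_list_def)
  moreover have "char_poly_matrix ?A $$ (i, j) = (if i = j then [:0, 1:] else 0)
      + [:- ([[a, b, c], [d, e, d], [c, b, a]] ! i ! j):]" if "i < 3" "j < 3" for i j
    using that by (simp add: char_poly_matrix_def mat_of_rows_list_def)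
  ultimately have *: "char_poly ?A =
    [:- a, 1:] * ([:- e, 1:] * [:- a, 1:] - [:- d:] * [:- b:])
  - [:- b:] * ([:- d:] * [:- a, 1:] - [:- d:] * [:- c:])
  + [:- c:] * ([:- d:] * [:- b:] - [:- e, 1:] * [:- c:])"
    unfolding char_poly_def by (subst det_dim_three) (simp_all del: mult_pCons_left mult_pCons_right)
  show ?thesis
    unfolding * by (simp only: a e) (simp add: algebra_simps)
qed

lemma lambda2_eq_max:
  assumes "char_poly A = [:- 1, 1:] * [:- \<mu>, 1:] * [:- \<nu>, 1:]" "\<mu> \<le> 1" "\<nu> \<le> 1"
  shows "lambda2 A = max \<mu> \<nu>"
proof -
  have "proots (char_poly A) = mset [1, \<mu>, \<nu>]"
    unfolding assms(1) by (simp add: proots_mult del: mult_pCons_left mult_pCons_right)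
  then have "lambda2 A = rev (sort [1, \<mu>, \<nu>]) ! 1"
    unfolding lambda2_def by (simp only: sorted_list_of_multiset_mset)
  with assms(2,3) show ?thesis
    by (auto simp: max_def)
qed

lemma lambda2_rotary_attention_three:
  fixes a \<beta> :: real
  assumes p: "p 0 = 0" "p 1 = 1" "p 2 = 2"
  defines "x \<equiv> exp (\<beta> * (a - 2))" and "y \<equiv> exp (- 2 * a * \<beta>)"
  shows "lambda2 (rotary_attention 3 \<beta> (pi / 2) pi p a) =
         max ((1 - y) / (1 + x + y)) (1 / (1 + 2 * x) - x / (1 + x + y))"
proof -
  define w where "w = rotary_weight \<beta> (pi / 2) pi p a"
  have pos: "x > 0" "y > 0" by (simp_all add: x_def y_def)
  have w_diag: "w i i = exp \<beta>" for i
    by (simp add: w_def rotary_weight_def)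
  have exponent_x: "exp (\<beta> * (a - 1)) = exp \<beta> * x"
    unfolding x_def exp_add[symmetric] by (simp add: algebra_simps)
  have exponent_y: "exp (\<beta> * (1 - 2 * a)) = exp \<beta> * y"
    unfolding y_def exp_add[symmetric] by (simp add: algebra_simps)
  have w_near: "w 0 1 = exp \<beta> * x" "w 1 0 = exp \<beta> * x" "w 1 2 = exp \<beta> * x" "w 2 1 = exp \<beta> * x"
    unfolding exponent_x[symmetric] by (simp_all add: w_def rotary_weight_def p[simplified])
  have w_far: "w 0 2 = exp \<beta> * y" "w 2 0 = exp \<beta> * y"
    unfolding exponent_y[symmetric]
    by (simp_all add: w_def rotary_weight_def p mult.commute[of pi])
  have "rotary_attention 3 \<beta> (pi / 2) pi p a = mat_of_rows_list 3
         [[1 / (1 + x + y), x / (1 + x + y), y / (1 + x + y)],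
          [x / (1 + 2 * x), 1 / (1 + 2 * x), x / (1 + 2 * x)],
          [y / (1 + x + y), x / (1 + x + y), 1 / (1 + x + y)]]" (is "?A = ?B")
  proof (rule eq_matI)
    have sums: "(\<Sum>k<3. w 0 k) = exp \<beta> * (1 + x + y)" "(\<Sum>k<3. w 1 k) = exp \<beta> * (1 + 2 * x)"
      "(\<Sum>k<3. w 2 k) = exp \<beta> * (1 + x + y)"
      using w_near w_far by (simp_all add: w_diag eval_nat_numeral algebra_simps)
    fix i j assume "i < dim_row ?B" "j < dim_col ?B"
    then have ij: "i < 3" "j < 3" by (simp_all add: mat_of_rows_list_def)
    then have "?A $$ (i, j) = w i j / (\<Sum>k<3. w i k)"
      by (simp add: rotary_attention_def w_def)
    moreover have "i = 0 \<or> i = 1 \<or> i = 2" "j = 0 \<or> j = 1 \<or> j = 2" using ij by auto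
    ultimately show "?A $$ (i, j) = ?B $$ (i, j)"
      using w_near w_far sums
      by (elim disjE) (simp_all add: w_diag mat_of_rows_list_def)
  qed (simp_all add: rotary_attention_def mat_of_rows_list_def)
  moreover have "1 / (1 + x + y) + x / (1 + x + y) + y / (1 + x + y) = 1"
    "2 * (x / (1 + 2 * x)) + 1 / (1 + 2 * x) = 1"
    using pos by (simp_all add: add_divide_distrib[symmetric])
  ultimately have "char_poly (rotary_attention 3 \<beta> (pi / 2) pi p a) =
      [:- 1, 1:] * [:- ((1 - y) / (1 + x + y)), 1:] * [:- (1 / (1 + 2 * x) - x / (1 + x + y)), 1:]"
    using char_poly_centrosymmetric_stochastic[of "1 / (1 + x + y)" "x / (1 + x + y)"
        "y / (1 + x + y)" "x / (1 + 2 * x)" "1 / (1 + 2 * x)"]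
    by (simp only: diff_divide_distrib[symmetric])
  moreover have "(1 - y) / (1 + x + y) \<le> 1"
    using pos by (simp add: field_simps)
  moreover have "1 / (1 + 2 * x) - x / (1 + x + y) \<le> 1 - 0"
    using pos by (intro diff_mono) (simp_all add: field_simps)
  ultimately show ?thesis
    by (intro lambda2_eq_max) simp_all
qed

theorem proposition7p4:
  fixes p :: "nat \<Rightarrow> real" and \<beta> \<omega>1 \<omega>2 u :: real and \<gamma> :: "real \<Rightarrow> real"
  assumes p: "p 0 = 0" "p 1 = 1" "p 2 = 2"
    and \<beta>: "\<beta> = 3 / 4 * ln 2"
    and \<omega>: "\<omega>1 = pi / 2" "\<omega>2 = pi"
    and \<gamma>: "\<And>a. a \<in> {0..1} \<Longrightarrow> \<gamma> a = 1 - lambda2 (rotary_attention 3 \<beta> \<omega>1 \<omega>2 p a)"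
    and u: "u = 2 powr (- 3 / 4)"
  shows "\<gamma> 0 = (35 * sqrt 2 - 32) / 31
       \<and> \<gamma> (2 / 3) = 3 / 4
       \<and> \<gamma> 1 = u * (1 + 2 * u) / (1 + u + u^2)
       \<and> \<gamma> (2 / 3) > max (\<gamma> 0) (\<gamma> 1)
       \<and> \<not> monotone_on {0..1} (\<le>) (\<le>) \<gamma>
       \<and> \<not> monotone_on {0..1} (\<le>) (\<ge>) \<gamma>"
proof -
  have gap: "\<gamma> a = 1 - max ((1 - exp (- 2 * a * \<beta>)) / (1 + exp (\<beta> * (a - 2)) + exp (- 2 * a * \<beta>)))
      (1 / (1 + 2 * exp (\<beta> * (a - 2))) -
       exp (\<beta> * (a - 2)) / (1 + exp (\<beta> * (a - 2)) + exp (- 2 * a * \<beta>)))"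
    if "a \<in> {0..1}" for a
    unfolding \<gamma>[OF that] \<omega> lambda2_rotary_attention_three[OF p] ..
  have exp_\<beta>: "exp (\<beta> * t) = 2 powr (3 / 4 * t)" for t
    by (simp add: \<beta> powr_def mult_ac)
  have u_pos: "0 < u" by (simp add: u)
  have u_pow4: "u ^ 4 = 1 / 8"
    by (simp add: u powr_power powr_minus divide_simps)
  \<comment> \<open>\<open>\<gamma> 1 < 3/4\<close> amounts to \<open>5 u\<^sup>2 + u < 3\<close>, which holds up to \<open>u \<approx> 0.68\<close>; the bound \<open>3/5\<close>
    suffices and follows from \<open>u\<^sup>4 = 1/8 < (3/5)\<^sup>4\<close>.\<close>
  have u_less: "u < 3 / 5"
    using power_mono[of "3 / 5" u 4] u_pow4 by (auto simp: eval_nat_numeral not_less[symmetric])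
  have u_sq_exp: "u\<^sup>2 = exp (\<beta> * (0 - 2))"
    unfolding exp_\<beta> by (simp add: u powr_power)
  have root2: "sqrt 2 * sqrt 2 = (2 :: real)" "0 < sqrt (2 :: real)" by simp_all
  have root2_less: "sqrt 2 < (3 / 2 :: real)"
    by (rule real_less_lsqrt) (simp_all add: power2_eq_square)
  have "(u\<^sup>2)\<^sup>2 = (sqrt 2 / 4)\<^sup>2"
    using u_pow4 by (simp add: power_divide power_mult[symmetric])
  then have "u\<^sup>2 = sqrt 2 / 4"
    by (rule power2_eq_imp_eq) simp_all
  with u_sq_exp have exp_0: "exp (\<beta> * (0 - 2)) = sqrt 2 / 4" by simp

  have "\<gamma> 0 = 1 - max 0 (1 / (1 + 2 * (sqrt 2 / 4)) - sqrt 2 / 4 / (1 + sqrt 2 / 4 + 1))"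
    by (subst gap) (simp_all only: exp_0, simp_all)
  also have "1 / (1 + 2 * (sqrt 2 / 4)) = 2 - sqrt 2"
    using root2
    by (subst nonzero_divide_eq_eq) (auto simp: field_simps add_pos_pos less_imp_neq[symmetric])
  also have "sqrt 2 / 4 / (1 + sqrt 2 / 4 + 1) = (4 * sqrt 2 - 1) / 31"
    using root2
    by (subst nonzero_divide_eq_eq) (auto simp: field_simps add_pos_pos less_imp_neq[symmetric])
  also have "max 0 (2 - sqrt 2 - (4 * sqrt 2 - 1) / 31) = 2 - sqrt 2 - (4 * sqrt 2 - 1) / 31"
    using root2_less by simp
  finally have gap_0: "\<gamma> 0 = (35 * sqrt 2 - 32) / 31" by (simp add: field_simps)

  have half: "exp (\<beta> * (2 / 3 - 2)) = 1 / 2" "exp (- 2 * (2 / 3) * \<beta>) = 1 / 2"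
    using exp_\<beta>[of "- 4 / 3"] by (simp_all add: powr_minus mult.commute)
  have gap_23: "\<gamma> (2 / 3) = 3 / 4"
    by (subst gap) (simp_all only: half, simp_all)

  have exp_1: "exp (\<beta> * (1 - 2)) = u" "exp (- 2 * 1 * \<beta>) = u\<^sup>2"
    using exp_\<beta>[of "- 1"] u_sq_exp by (simp_all add: u mult.commute)
  have den_pos: "0 < 1 + u + u\<^sup>2" using u_pos by (simp add: add_pos_pos)
  \<comment> \<open>Cross-multiplied, this inequality between the two modes is \<open>2 u\<^sup>3 \<le> 2 u\<close>.\<close>
  have "1 / (1 + 2 * u) \<le> (1 + u - u\<^sup>2) / (1 + u + u\<^sup>2)"
  proof -
    have "u * u\<^sup>2 \<le> u * 1"
      using u_pos u_less by (intro mult_left_mono) (auto simp: power_le_one)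
    then have "1 + u + u\<^sup>2 \<le> (1 + u - u\<^sup>2) * (1 + 2 * u)"
      by (simp add: algebra_simps power2_eq_square)
    then show ?thesis
      using u_pos den_pos by (simp add: divide_simps)
  qed
  then have "1 / (1 + 2 * u) - u / (1 + u + u\<^sup>2) \<le> (1 - u\<^sup>2) / (1 + u + u\<^sup>2)"
    by (simp add: add_divide_distrib diff_divide_distrib)
  moreover have "\<gamma> 1 = 1 - max ((1 - u\<^sup>2) / (1 + u + u\<^sup>2)) (1 / (1 + 2 * u) - u / (1 + u + u\<^sup>2))"
    by (subst gap) (simp_all only: exp_1, simp_all)
  ultimately have "\<gamma> 1 = 1 - (1 - u\<^sup>2) / (1 + u + u\<^sup>2)" by (simp add: max_absorb1)
  then have gap_1: "\<gamma> 1 = u * (1 + 2 * u) / (1 + u + u\<^sup>2)"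
    using den_pos by (simp add: field_simps power2_eq_square)

  have less_0: "\<gamma> 0 < \<gamma> (2 / 3)" unfolding gap_0 gap_23 using root2_less by simp
  have "u\<^sup>2 < (3 / 5)\<^sup>2" using u_pos u_less by (intro power_strict_mono) auto
  then have "u * (1 + 2 * u) * 4 < 3 * (1 + u + u\<^sup>2)"
    using u_less by (simp add: algebra_simps power2_eq_square)
  then have less_1: "\<gamma> 1 < \<gamma> (2 / 3)"
    unfolding gap_1 gap_23 using den_pos by (simp add: divide_simps)

  have "\<not> monotone_on {0..1} (\<le>) (\<le>) \<gamma>"
    using less_1 monotone_onD[of "{0..1}" "(\<le>)" "(\<le>)" \<gamma> "2 / 3" 1] by auto
  moreover have "\<not> monotone_on {0..1} (\<le>) (\<ge>) \<gamma>"
    using less_0 monotone_onD[of "{0..1}" "(\<le>)" "(\<ge>)" \<gamma> 0 "2 / 3"] by auto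
  ultimately show ?thesis
    using gap_0 gap_23 gap_1 less_0 less_1 by simp
qed

end
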